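(* For every integer $n\ge5$ there are $a_0,\ldots,a_{n-1}\in\mathbb{C}$ such that no root of the equation $x^n+a_{n-1}x^{n-1}+\ldots+a_1x+a_0=0$ is contained in any radical extension of $\mathbb{Q}_\varepsilon(a_{n-1},\ldots,a_0)$ which is contained in $\mathbb{Q}_\varepsilon(x_1,\ldots,x_n)$, where $x_1,\ldots,x_n\in\mathbb{C}$ are the roots of the equation.
   Context: For an integer $k\ge 1$ let $\varepsilon_k:=\cos\frac{2\pi}{k}+i\sin\frac{2\pi}{k}$, and let $\mathbb{Q}_\varepsilon:=\bigcup_{k=3}^\infty\mathbb{Q}(\varepsilon_3,\varepsilon_4,\ldots,\varepsilon_k)\subset\mathbb{C}$. For a field $F\subset\mathbb{C}$ and numbers $r_1,\ldots,r_s\in\mathbb{C}$, the extension $F(r_1,\ldots,r_s)\subset\mathbb{C}$ is the set of all values (where defined) at $(r_1,\ldots,r_s)$ of rational functions in $s$ variables with coefficients in $F$, i.e. the subfield of $\mathbb{C}$ generated by $F$ and $r_1,\ldots,r_s$. The extension $F(r_1,\ldots,r_s)$ of $F$ is called a radical extension if for every $j=1,\ldots,s$ there is a positive integer $k_j$ such that $r_j^{k_j}\in F(r_1,\ldots,r_{j-1})$ (for $j=1$ this field is $F$). *)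

theory Defs
  imports Complex_Main "HOL-Algebra.Generated_Fields" "HOL-Algebra.Algebraic_Closure_Type"
begin

abbreviation complex_ring :: "complex ring" where
  "complex_ring \<equiv> ring_of_type_algebra"

definition adjoin :: "complex set \<Rightarrow> complex set \<Rightarrow> complex set" where
  "adjoin F S = generate_field complex_ring (F \<union> S)"

definition eps :: "nat \<Rightarrow> complex" where
  "eps k = Complex (cos (2 * pi / real k)) (sin (2 * pi / real k))"

definition Q_eps :: "complex set" where
  "Q_eps = (\<Union>k\<in>{3..}. adjoin \<rat> (eps ` {3..k}))"

(* Only meant for subfields F. The case s = 0 gives the trivial extension of F, which is
   also obtained from s = 1 and r 1 = 1. *)
definition radical_extension :: "complex set \<Rightarrow> complex set \<Rightarrow> bool" where
  "radical_extension F K \<longleftrightarrow>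
     (\<exists>(s::nat) (r :: nat \<Rightarrow> complex).
        K = adjoin F (r ` {1..s}) \<and>
        (\<forall>j\<in>{1..s}. \<exists>k>0. r j ^ k \<in> adjoin F (r ` {1..<j})))"

lemma complex_ring_simps [simp]:
  "carrier complex_ring = UNIV"
  "\<zero>\<^bsub>complex_ring\<^esub> = 0"
  "\<one>\<^bsub>complex_ring\<^esub> = 1"
  "x \<oplus>\<^bsub>complex_ring\<^esub> y = x + y"
  "x \<otimes>\<^bsub>complex_ring\<^esub> y = x * y"
  by (simp_all add: ring_of_type_algebra_def)

lemma field_complex_ring: "field complex_ring"
  by (rule field_from_type_algebra)

lemma subfield_adjoin: "subfield (adjoin F S) complex_ring"
  unfolding adjoin_def
  by (rule field.generate_field_is_subfield[OF field_complex_ring]) simp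

lemma adjoin_eq_Inter:
  "adjoin F S = \<Inter>{K. subfield K complex_ring \<and> F \<union> S \<subseteq> K}"
  unfolding adjoin_def
  by (rule field.generate_field_min_subfield2[OF field_complex_ring]) simp

end

theory Submission
  imports Defs "HOL-Analysis.Continuum_Not_Denumerable" "HOL-Combinatorics.Permutations"
begin

text \<open>
  Take roots \<open>x\<^sub>1, \<dots>, x\<^sub>n\<close> that are algebraically independent over the countable field \<open>F\<close> generated by
  \<open>Q_eps\<close>, so that permutations of the roots act as automorphisms of \<open>F(x\<^sub>1, \<dots>, x\<^sub>n)\<close>.
  If \<open>r ^ k\<close> is fixed by all 3-cycles, then every 3-cycle multiplies \<open>r\<close> by a root of unity,
  which lies in \<open>F\<close>; hence any two 3-cycles commute on \<open>r\<close>. For \<open>n \<ge> 5\<close> each 3-cycle is a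
  commutator of 3-cycles, so \<open>r\<close> itself is fixed by all 3-cycles. Thus a whole
  radical extension inside \<open>F(x\<^sub>1, \<dots>, x\<^sub>n)\<close> is fixed by all 3-cycles, whereas no root is.
\<close>

section \<open>Subfields of the complex numbers\<close>

text \<open>Uniqueness of negatives and inverses identifies the operations of
  \<open>complex_ring\<close> with those of the type. Since \<open>inverse 0 = 0\<close>, closure
  under \<open>inverse\<close> can be stated without excluding 0.\<close>

lemma subfield_complex_iff:
  "subfield K complex_ring \<longleftrightarrow>
     1 \<in> K \<and> (\<forall>a\<in>K. - a \<in> K) \<and> (\<forall>a\<in>K. inverse a \<in> K) \<and>
     (\<forall>a\<in>K. \<forall>b\<in>K. a + b \<in> K) \<and> (\<forall>a\<in>K. \<forall>b\<in>K. a * b \<in> K)"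
    (is "_ \<longleftrightarrow> ?closed")
proof -
  interpret C: field complex_ring by (rule field_complex_ring)
  have uminus: "\<ominus>\<^bsub>complex_ring\<^esub> a = - a" for a :: complex
    by (rule C.minus_equality) simp_all
  have inverse: "inv\<^bsub>complex_ring\<^esub> a = inverse a" if "a \<noteq> 0" for a :: complex
    using C.inv_unique'[of a "inverse a"] that by simp
  show ?thesis
  proof
    assume K: "subfield K complex_ring"
    note ring = subringE[OF subfieldE(1)[OF K]]
    have "inverse a \<in> K" if "a \<in> K" for a
    proof (cases "a = 0")
      case False
      then show ?thesis using C.subfield_m_inv(1)[OF K, of a] that inverse by simp
    qed (use that in simp)
    then show ?closed using ring uminus by auto
  next
    assume closed: ?closed
    show "subfield K complex_ring"
    proof (rule C.subfieldI')
      show "subring K complex_ring"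
        by (rule C.subringI) (use closed uminus in auto)
    qed (use closed inverse in auto)
  qed
qed

lemma
  assumes "subfield K complex_ring"
  shows subfield_one: "1 \<in> K"
    and subfield_uminus: "a \<in> K \<Longrightarrow> - a \<in> K"
    and subfield_inverse: "a \<in> K \<Longrightarrow> inverse a \<in> K"
    and subfield_add: "a \<in> K \<Longrightarrow> b \<in> K \<Longrightarrow> a + b \<in> K"
    and subfield_mult: "a \<in> K \<Longrightarrow> b \<in> K \<Longrightarrow> a * b \<in> K"
  using assms by (auto simp: subfield_complex_iff)

lemma subfield_zero: "subfield K complex_ring \<Longrightarrow> 0 \<in> K"
  using subfield_one subfield_uminus subfield_add by (metis add.right_inverse)

lemma subfield_power: "subfield K complex_ring \<Longrightarrow> a \<in> K \<Longrightarrow> a ^ k \<in> K"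
  by (induction k) (auto intro: subfield_one subfield_mult)

lemma subfield_infinite:
  assumes "subfield K complex_ring"
  shows "infinite K"
proof -
  have "of_nat m \<in> K" for m
    by (induction m) (auto intro: subfield_zero subfield_one subfield_add assms)
  then have "range (of_nat :: nat \<Rightarrow> complex) \<subseteq> K" by blast
  then show ?thesis
    using finite_subset range_inj_infinite[of "of_nat :: nat \<Rightarrow> complex"] inj_of_nat by blast
qed

lemma adjoin_subset_iff: "subfield K complex_ring \<Longrightarrow> adjoin F S \<subseteq> K \<longleftrightarrow> F \<subseteq> K \<and> S \<subseteq> K"
  unfolding adjoin_eq_Inter by blast

lemma subset_adjoin: "F \<subseteq> adjoin F S" "S \<subseteq> adjoin F S"
  unfolding adjoin_eq_Inter by blast+

text \<open>Climb the tower: once the earlier generators lie in \<open>E\<close>, a power of the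
  next one does too. Closure of \<open>E\<close> under roots is asked only inside \<open>K\<close>,
  because the fixed field used later has it only within the field generated by the generic
  roots.\<close>

lemma radical_extension_subset:
  assumes "radical_extension F K" and E: "subfield E complex_ring" "F \<subseteq> E"
    and root: "\<And>u k. u \<in> K \<Longrightarrow> k > 0 \<Longrightarrow> u ^ k \<in> E \<Longrightarrow> u \<in> E"
  shows "K \<subseteq> E"
proof -
  obtain s :: nat and r where K: "K = adjoin F (r ` {1..s})"
    and rad: "\<forall>j\<in>{1..s}. \<exists>k>0. r j ^ k \<in> adjoin F (r ` {1..<j})"
    using assms(1) unfolding radical_extension_def by blast
  have "r j \<in> E" if "j \<in> {1..s}" for j
    using that
  proof (induction j rule: less_induct)
    case (less j)
    then have "adjoin F (r ` {1..<j}) \<subseteq> E"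
      using E(2) unfolding adjoin_subset_iff[OF E(1)] by auto
    moreover obtain k where "k > 0" "r j ^ k \<in> adjoin F (r ` {1..<j})"
      using bspec[OF rad less.prems] by blast
    moreover have "r j \<in> K"
      unfolding K using subset_adjoin(2) less.prems by blast
    ultimately show ?case using root by blast
  qed
  then show ?thesis
    unfolding K adjoin_subset_iff[OF E(1)] using E(2) by blast
qed

section \<open>Countability\<close>

text \<open>\<open>A m\<close> collects what at most \<open>m\<close> rounds of operations produce
  from \<open>G\<close>; each stage is countable, and so is their union. Unary operations fit in as
  binary ones that ignore an argument.\<close>

lemma countable_closure:
  fixes ops :: "('a \<Rightarrow> 'a \<Rightarrow> 'a) set"
  assumes "countable G" "countable ops"
  obtains C where "countable C" "G \<subseteq> C" "\<And>f a b. f \<in> ops \<Longrightarrow> a \<in> C \<Longrightarrow> b \<in> C \<Longrightarrow> f a b \<in> C"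
proof -
  define A where "A = rec_nat G (\<lambda>_ A. A \<union> (\<Union>f\<in>ops. (\<lambda>(a, b). f a b) ` (A \<times> A)))"
  have A_0: "A 0 = G"
    and A_Suc: "A (Suc m) = A m \<union> (\<Union>f\<in>ops. (\<lambda>(a, b). f a b) ` (A m \<times> A m))" for m
    by (simp_all add: A_def)
  have mono: "A i \<subseteq> A j" if "i \<le> j" for i j
    using lift_Suc_mono_le[of A i j] that A_Suc by blast
  have "countable (A m)" for m
    by (induction m) (use assms in \<open>auto simp: A_0 A_Suc\<close>)
  then have "countable (\<Union>m. A m)" by simp
  moreover have "G \<subseteq> (\<Union>m. A m)" using A_0 by blast
  moreover have "f a b \<in> (\<Union>m. A m)"
    if "f \<in> ops" "a \<in> (\<Union>m. A m)" "b \<in> (\<Union>m. A m)" for f a b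
  proof -
    from that obtain i j where "a \<in> A i" "b \<in> A j" by blast
    then have "a \<in> A (max i j)" "b \<in> A (max i j)" 
      using subsetD[OF mono[of i "max i j"]] subsetD[OF mono[of j "max i j"]] by simp_all
    then have "f a b \<in> A (Suc (max i j))" using \<open>f \<in> ops\<close> unfolding A_Suc by force
    then show ?thesis by blast
  qed
  ultimately show thesis using that by blast
qed

text \<open>A countable set containing \<open>F\<close>, \<open>S\<close> and 1 and closed under the
  field operations is a subfield, so it contains the generated one.\<close>

lemma countable_adjoin:
  assumes "countable F" "countable S"
  shows "countable (adjoin F S)"
proof -
  obtain C where C: "countable C" "insert 1 (F \<union> S) \<subseteq> C"
    and closed: "\<And>f a b. f \<in> {(+), (*), \<lambda>a _. - a, \<lambda>a _. inverse a} \<Longrightarrow> a \<in> C \<Longrightarrow> b \<in> C \<Longrightarrow> f a b \<in> C"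
    using countable_closure[of "insert 1 (F \<union> S)" "{(+), (*), \<lambda>a _. - a, \<lambda>a _. inverse a}"] assms
    by auto
  have "subfield C complex_ring"
    unfolding subfield_complex_iff using C(2) closed by auto
  then have "adjoin F S \<subseteq> C" using C(2) by (simp add: adjoin_subset_iff)
  then show ?thesis using C(1) countable_subset by blast
qed

lemma countable_Q_eps: "countable Q_eps"
  unfolding Q_eps_def by (intro countable_UN countable_adjoin) (auto simp: countable_rat)

lemma root_of_unity_in_adjoin_Q_eps:
  assumes "\<zeta> ^ k = 1" "k > 0"
  shows "\<zeta> \<in> adjoin Q_eps S"
proof -
  \<comment> \<open>The factor 3 gives \<open>m \<ge> 3\<close>, as \<open>Q_eps\<close> starts with
    \<open>eps 3\<close>; every \<open>k\<close>-th root of unity is also an \<open>m\<close>-th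
    one.\<close>
  define m where "m = 3 * k"
  have m: "m \<ge> 3" "\<zeta> ^ m = 1" using assms by (auto simp: m_def power_mult mult.commute)
  then obtain j where "\<zeta> = cis (2 * pi * real j / real m)"
    using bij_betw_imp_surj_on[OF bij_betw_roots_unity[of m]] by force
  also have "\<dots> = eps m ^ j"
    using DeMoivre[of "2 * pi / real m" j] by (simp add: eps_def cis.code mult_ac)
  finally have "\<zeta> = eps m ^ j" .
  moreover have "eps m \<in> Q_eps"
    unfolding Q_eps_def using m(1) subset_adjoin(2)[of "eps ` {3..m}" \<rat>] by fastforce
  ultimately show ?thesis using subset_adjoin(1) subfield_power[OF subfield_adjoin] by blast
qed

section \<open>Polynomial functions and generic points\<close>

text \<open>Multivariate polynomials are taken as functions of the assignment of values to
  variables, so that permuting or specializing variables is just a change of the argument.\<close>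

inductive_set polyfun :: "'a::comm_ring_1 set \<Rightarrow> 'v set \<Rightarrow> (('v \<Rightarrow> 'a) \<Rightarrow> 'a) set"
  for F V where
  const: "c \<in> F \<Longrightarrow> (\<lambda>_. c) \<in> polyfun F V"
| var: "v \<in> V \<Longrightarrow> (\<lambda>y. y v) \<in> polyfun F V"
| add: "p \<in> polyfun F V \<Longrightarrow> q \<in> polyfun F V \<Longrightarrow> (\<lambda>y. p y + q y) \<in> polyfun F V"
| mult: "p \<in> polyfun F V \<Longrightarrow> q \<in> polyfun F V \<Longrightarrow> (\<lambda>y. p y * q y) \<in> polyfun F V"

lemma countable_polyfun:
  assumes "countable F" "countable V"
  shows "countable (polyfun F V)"
proof -
  obtain C where C: "countable C" "(\<lambda>c _. c) ` F \<union> (\<lambda>v y. y v) ` V \<subseteq> C"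
    and closed: "\<And>f p q. f \<in> {\<lambda>p q y. p y + q y, \<lambda>p q y. p y * q y} \<Longrightarrow>
      p \<in> C \<Longrightarrow> q \<in> C \<Longrightarrow> f p q \<in> C"
    using countable_closure[of "(\<lambda>c _. c) ` F \<union> (\<lambda>v y. y v) ` V"
        "{\<lambda>p q y. p y + q y, \<lambda>p q y. p y * q y}"] assms
    by auto
  have "p \<in> C" if "p \<in> polyfun F V" for p
    using that
  proof induction
    case (const c)
    show ?case by (rule subsetD[OF C(2) UnI1[OF imageI[OF const]]])
  next
    case (var v)
    show ?case by (rule subsetD[OF C(2) UnI2[OF imageI[OF var]]])
  next
    case (add p q)
    show ?case by (rule closed[OF insertI1 add.IH])
  next
    case (mult p q)
    show ?case by (rule closed[OF insertI2[OF singletonI] mult.IH])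
  qed
  then have "polyfun F V \<subseteq> C" by (rule subsetI)
  then show ?thesis using C(1) by (rule countable_subset)
qed

text \<open>Freezing all variables but \<open>v\<close> makes the finiteness of the root set of a
  univariate polynomial available.\<close>

lemma polyfun_eq_poly:
  assumes "p \<in> polyfun F V"
  shows "\<exists>q. \<forall>t. p (y(v := t)) = poly q t"
  using assms
proof induction
  case (const c)
  show ?case by (rule exI[of _ "[:c:]"]) simp
next
  case (var w)
  show ?case by (rule exI[of _ "if w = v then [:0, 1:] else [:y w:]"]) simp
next
  case (add p q)
  then show ?case by (metis poly_add)
next
  case (mult p q)
  then show ?case by (metis poly_mult)
qed

lemma polyfun_specialize:
  assumes "p \<in> polyfun F (insert v V)" "c \<in> F"
  shows "(\<lambda>y. p (y(v := c))) \<in> polyfun F V"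
  using assms(1)
proof induction
  case (var w)
  then show ?case by (cases "w = v") (auto intro: polyfun.intros assms(2))
qed (auto intro: polyfun.intros assms(2))

lemma polyfun_permute:
  assumes "p \<in> polyfun F V" "\<sigma> ` V \<subseteq> V"
  shows "(\<lambda>y. p (y \<circ> \<sigma>)) \<in> polyfun F V"
  using assms(1) by induction (use assms(2) in \<open>auto intro: polyfun.intros\<close>)

text \<open>
  The coordinates of \<open>x\<close> indexed by \<open>V\<close> are then algebraically independent over \<open>F\<close>.
\<close>
definition generic :: "complex set \<Rightarrow> 'v set \<Rightarrow> ('v \<Rightarrow> complex) \<Rightarrow> bool" where
  "generic F V x \<longleftrightarrow> (\<forall>p\<in>polyfun F V. p x = 0 \<longrightarrow> (\<forall>y. p y = 0))"

text \<open>Coordinates are chosen one at a time: countably many polynomial functions exclude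
  finitely many values each, while the complex numbers are uncountable.\<close>

lemma ex_generic:
  fixes V :: "'v set"
  assumes F: "countable F" "infinite F" and "finite V"
  shows "\<exists>x. generic F V x"
  using \<open>finite V\<close>
proof (induction V rule: finite_induct)
  case empty
  \<comment> \<open>Without variables, polynomial functions are constant.\<close>
  have "p y = p z" if "p \<in> polyfun F {}" for p and y z :: "'v \<Rightarrow> complex"
    using that by induction auto
  then show ?case unfolding generic_def by metis
next
  case (insert v V)
  then obtain x where x: "generic F V x" by blast
  \<comment> \<open>The forbidden values for coordinate \<open>v\<close>: roots of those polynomial
    functions that do not vanish on the whole line through \<open>x\<close> in direction
    \<open>v\<close>.\<close>
  define B where "B = (\<Union>p\<in>{p \<in> polyfun F (insert v V). \<exists>s. p (x(v := s)) \<noteq> 0}.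
    {t. p (x(v := t)) = 0})"
  have "finite {t. p (x(v := t)) = 0}"
    if p: "p \<in> polyfun F W" "p (x(v := s)) \<noteq> 0" for p s W
  proof -
    obtain q where q: "\<And>t. p (x(v := t)) = poly q t"
      using polyfun_eq_poly[OF p(1), of x v] by blast
    with p(2) have "q \<noteq> 0" by auto
    then show ?thesis using poly_roots_finite q by simp
  qed
  moreover have "countable (polyfun F (insert v V))"
    using F(1) insert.hyps(1) by (intro countable_polyfun) (auto simp: countable_finite)
  ultimately have "countable B"
    unfolding B_def by (intro countable_UN countable_Collect) (auto intro: countable_finite)
  then obtain t where t: "t \<notin> B"
    using uncountable_UNIV_complex by (metis UNIV_I countable_subset subsetI)
  have "p y = 0" if p: "p \<in> polyfun F (insert v V)" "p (x(v := t)) = 0" for p y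
  proof -
    \<comment> \<open>So \<open>p\<close> vanishes on that whole line. Setting \<open>v\<close> to
      some \<open>c \<in> F\<close> leaves a polynomial function in \<open>V\<close> that is zero at
      the generic \<open>x\<close>, hence everywhere; along \<open>v\<close> from any
      \<open>y\<close>, \<open>p\<close> then has all of the infinite \<open>F\<close> as
      roots.\<close>
    have "p (x(v := s)) = 0" for s using t p unfolding B_def by blast
    then have "p (y(v := c)) = 0" if "c \<in> F" for c
      using bspec[OF x[unfolded generic_def] polyfun_specialize[OF p(1) that]] by metis
    moreover obtain q where q: "\<And>t. p (y(v := t)) = poly q t"
      using polyfun_eq_poly[OF p(1), of y v] by blast
    ultimately have "F \<subseteq> {c. poly q c = 0}" by auto
    then have "q = 0" using F(2) poly_roots_finite finite_subset by blast
    then show "p y = 0" using q[of "y v"] by simp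
  qed
  then show ?case unfolding generic_def by blast
qed

section \<open>Permuting the coordinates of a generic point\<close>

locale generic_point =
  fixes F :: "complex set" and V :: "'v set" and x :: "'v \<Rightarrow> complex"
  assumes subfield: "subfield F complex_ring" and generic: "generic F V x"
begin

lemma polyfun_zeroD:
  assumes "p \<in> polyfun F V" "p x = 0"
  shows "p y = 0"
proof -
  have "p x = 0 \<longrightarrow> (\<forall>y. p y = 0)"
    using generic assms(1) unfolding generic_def by (rule bspec)
  then show ?thesis using assms(2) by (rule mp[THEN spec])
qed

text \<open>Identities at the generic point hold everywhere; the difference is written with a factor
  \<open>- 1\<close> because \<open>polyfun\<close> has no rule for subtraction.\<close>

lemma polyfun_eqD:
  assumes "p \<in> polyfun F V" "q \<in> polyfun F V" "p x = q x"
  shows "p y = q y"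
proof -
  have "- 1 \<in> F" using subfield by (simp add: subfield_one subfield_uminus)
  then have "(\<lambda>y. p y + (- 1) * q y) \<in> polyfun F V"
    using assms(1,2) by (intro polyfun.intros)
  then have "p y + (- 1) * q y = 0" by (rule polyfun_zeroD) (simp add: assms(3))
  then show ?thesis by simp
qed

text \<open>If \<open>q\<close> vanished at the permuted point, then
  \<open>q (y \<circ> \<sigma>)\<close> would vanish for every \<open>y\<close>; taking for
  \<open>y\<close> the point permuted by the inverse of \<sigma> returns
  \<open>q x = 0\<close>.\<close>

lemma polyfun_permute_nonzero:
  assumes "q \<in> polyfun F V" "q x \<noteq> 0" "\<sigma> permutes V"
  shows "q (x \<circ> \<sigma>) \<noteq> 0"
proof
  assume zero: "q (x \<circ> \<sigma>) = 0"
  have "(\<lambda>y. q (y \<circ> \<sigma>)) \<in> polyfun F V"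
    by (rule polyfun_permute[OF assms(1)]) (simp add: permutes_image[OF assms(3)])
  then have "q ((x \<circ> Hilbert_Choice.inv \<sigma>) \<circ> \<sigma>) = 0"
    using zero by (rule polyfun_zeroD)
  then show False using assms(2) permutes_inv_o(2)[OF assms(3)] by (simp add: o_assoc[symmetric])
qed

text \<open>This is the extension of \<open>F\<close> by the coordinates \<open>x v\<close> with
  \<open>v \<in> V\<close>, written out as fractions so that automorphisms can be defined on
  numerator and denominator.\<close>

definition ratvals :: "complex set" where
  "ratvals = {p x / q x |p q. p \<in> polyfun F V \<and> q \<in> polyfun F V \<and> q x \<noteq> 0}"

lemma ratvalsI:
  "p \<in> polyfun F V \<Longrightarrow> q \<in> polyfun F V \<Longrightarrow> q x \<noteq> 0 \<Longrightarrow> u = p x / q x \<Longrightarrow> u \<in> ratvals"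
  unfolding ratvals_def by blast

lemma ratvalsE:
  assumes "u \<in> ratvals"
  obtains p q where "p \<in> polyfun F V" "q \<in> polyfun F V" "q x \<noteq> 0" "u = p x / q x"
  using assms unfolding ratvals_def by blast

text \<open>The automorphism of \<open>ratvals\<close> induced by permuting the variables. It is
  given by a description because a value has many representing fractions; outside
  \<open>ratvals\<close> it is unspecified.\<close>

definition act :: "('v \<Rightarrow> 'v) \<Rightarrow> complex \<Rightarrow> complex" where
  "act \<sigma> u = (THE w. \<exists>p q. p \<in> polyfun F V \<and> q \<in> polyfun F V \<and> q x \<noteq> 0 \<and>
     u = p x / q x \<and> w = p (x \<circ> \<sigma>) / q (x \<circ> \<sigma>))"

text \<open>Well-definedness: two fractions for one number satisfy a cross-multiplied identity at
  \<open>x\<close>, which genericity carries over to the permuted point, where the denominators stay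
  nonzero.\<close>

lemma act_eq:
  assumes "p \<in> polyfun F V" "q \<in> polyfun F V" "q x \<noteq> 0" "\<sigma> permutes V"
  shows "act \<sigma> (p x / q x) = p (x \<circ> \<sigma>) / q (x \<circ> \<sigma>)"
  unfolding act_def
proof (rule the_equality)
  fix w
  assume "\<exists>p' q'. p' \<in> polyfun F V \<and> q' \<in> polyfun F V \<and> q' x \<noteq> 0 \<and>
    p x / q x = p' x / q' x \<and> w = p' (x \<circ> \<sigma>) / q' (x \<circ> \<sigma>)"
  then obtain p' q' where pq': "p' \<in> polyfun F V" "q' \<in> polyfun F V" "q' x \<noteq> 0"
    "p x / q x = p' x / q' x" and w: "w = p' (x \<circ> \<sigma>) / q' (x \<circ> \<sigma>)" by blast
  then have "p x * q' x = p' x * q x" using frac_eq_eq[OF assms(3)] by blast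
  then have "p (x \<circ> \<sigma>) * q' (x \<circ> \<sigma>) = p' (x \<circ> \<sigma>) * q (x \<circ> \<sigma>)"
    using polyfun_eqD[OF polyfun.mult[OF assms(1) pq'(2)] polyfun.mult[OF pq'(1) assms(2)]]
    by blast
  moreover have "q (x \<circ> \<sigma>) \<noteq> 0" "q' (x \<circ> \<sigma>) \<noteq> 0"
    by (rule polyfun_permute_nonzero[OF _ _ assms(4)]; fact)+
  ultimately have "p (x \<circ> \<sigma>) / q (x \<circ> \<sigma>) = p' (x \<circ> \<sigma>) / q' (x \<circ> \<sigma>)"
    by (rule iffD2[OF frac_eq_eq, rotated 2])
  with w show "w = p (x \<circ> \<sigma>) / q (x \<circ> \<sigma>)" by (rule trans[OF _ sym])
qed (use assms in blast)

lemma act_polyfun: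
  assumes "p \<in> polyfun F V" "\<sigma> permutes V"
  shows "p x \<in> ratvals" "act \<sigma> (p x) = p (x \<circ> \<sigma>)"
proof -
  have one: "(\<lambda>_. 1) \<in> polyfun F V" using subfield_one[OF subfield] by (rule polyfun.const)
  show "p x \<in> ratvals" by (rule ratvalsI[OF assms(1) one]) simp_all
  show "act \<sigma> (p x) = p (x \<circ> \<sigma>)" using act_eq[OF assms(1) one _ assms(2)] by simp
qed

lemma act_const:
  assumes "c \<in> F" "\<sigma> permutes V"
  shows "c \<in> ratvals" "act \<sigma> c = c"
  using act_polyfun[OF polyfun.const[OF assms(1)] assms(2)] by simp_all

lemma act_var:
  assumes "v \<in> V" "\<sigma> permutes V"
  shows "x v \<in> ratvals" "act \<sigma> (x v) = x (\<sigma> v)"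
  using act_polyfun[OF polyfun.var[OF assms(1)] assms(2)] by simp_all

lemma act_add:
  assumes "u \<in> ratvals" "w \<in> ratvals" "\<sigma> permutes V"
  shows "u + w \<in> ratvals" "act \<sigma> (u + w) = act \<sigma> u + act \<sigma> w"
proof -
  obtain p q where u: "p \<in> polyfun F V" "q \<in> polyfun F V" "q x \<noteq> 0" "u = p x / q x"
    using ratvalsE[OF assms(1)] .
  obtain r s where w: "r \<in> polyfun F V" "s \<in> polyfun F V" "s x \<noteq> 0" "w = r x / s x"
    using ratvalsE[OF assms(2)] .
  let ?p = "\<lambda>y. p y * s y + r y * q y" and ?q = "\<lambda>y. q y * s y"
  have pq: "?p \<in> polyfun F V" "?q \<in> polyfun F V" "?q x \<noteq> 0"
    by (intro polyfun.add polyfun.mult u w) (intro polyfun.mult u w, simp add: u w)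
  have eq: "u + w = ?p x / ?q x" using u w by (simp add: add_frac_eq)
  show "u + w \<in> ratvals" by (rule ratvalsI[OF pq eq])
  have "act \<sigma> (u + w) = ?p (x \<circ> \<sigma>) / ?q (x \<circ> \<sigma>)"
    unfolding eq by (rule act_eq[OF pq assms(3)])
  also have "\<dots> = p (x \<circ> \<sigma>) / q (x \<circ> \<sigma>) + r (x \<circ> \<sigma>) / s (x \<circ> \<sigma>)"
    by (rule add_frac_eq[symmetric]; rule polyfun_permute_nonzero[OF _ _ assms(3)]; fact)
  also have "p (x \<circ> \<sigma>) / q (x \<circ> \<sigma>) = act \<sigma> u"
    unfolding u(4) by (rule act_eq[OF u(1-3) assms(3), symmetric])
  also have "r (x \<circ> \<sigma>) / s (x \<circ> \<sigma>) = act \<sigma> w"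
    unfolding w(4) by (rule act_eq[OF w(1-3) assms(3), symmetric])
  finally show "act \<sigma> (u + w) = act \<sigma> u + act \<sigma> w" .
qed

lemma act_mult:
  assumes "u \<in> ratvals" "w \<in> ratvals" "\<sigma> permutes V"
  shows "u * w \<in> ratvals" "act \<sigma> (u * w) = act \<sigma> u * act \<sigma> w"
proof -
  obtain p q where u: "p \<in> polyfun F V" "q \<in> polyfun F V" "q x \<noteq> 0" "u = p x / q x"
    using ratvalsE[OF assms(1)] .
  obtain r s where w: "r \<in> polyfun F V" "s \<in> polyfun F V" "s x \<noteq> 0" "w = r x / s x"
    using ratvalsE[OF assms(2)] .
  let ?p = "\<lambda>y. p y * r y" and ?q = "\<lambda>y. q y * s y"
  have pq: "?p \<in> polyfun F V" "?q \<in> polyfun F V" "?q x \<noteq> 0"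
    by (intro polyfun.add polyfun.mult u w) (intro polyfun.mult u w, simp add: u w)
  have eq: "u * w = ?p x / ?q x" using u w by simp
  show "u * w \<in> ratvals" by (rule ratvalsI[OF pq eq])
  have "act \<sigma> (u * w) = ?p (x \<circ> \<sigma>) / ?q (x \<circ> \<sigma>)"
    unfolding eq by (rule act_eq[OF pq assms(3)])
  also have "\<dots> = p (x \<circ> \<sigma>) / q (x \<circ> \<sigma>) * (r (x \<circ> \<sigma>) / s (x \<circ> \<sigma>))"
    by (rule times_divide_times_eq[symmetric])
  also have "p (x \<circ> \<sigma>) / q (x \<circ> \<sigma>) = act \<sigma> u"
    unfolding u(4) by (rule act_eq[OF u(1-3) assms(3), symmetric])
  also have "r (x \<circ> \<sigma>) / s (x \<circ> \<sigma>) = act \<sigma> w"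
    unfolding w(4) by (rule act_eq[OF w(1-3) assms(3), symmetric])
  finally show "act \<sigma> (u * w) = act \<sigma> u * act \<sigma> w" .
qed

lemma act_inverse:
  assumes "u \<in> ratvals" "\<sigma> permutes V"
  shows "inverse u \<in> ratvals" "act \<sigma> (inverse u) = inverse (act \<sigma> u)"
proof -
  have zero: "0 \<in> ratvals" "act \<sigma> 0 = 0"
    using act_const[OF subfield_zero[OF subfield] assms(2)] .
  obtain p q where u: "p \<in> polyfun F V" "q \<in> polyfun F V" "q x \<noteq> 0" "u = p x / q x"
    using ratvalsE[OF assms(1)] .
  have "inverse u \<in> ratvals \<and> act \<sigma> (inverse u) = inverse (act \<sigma> u)"
  \<comment> \<open>Swapping numerator and denominator needs a nonzero numerator; otherwise
    \<open>u = 0\<close> and \<open>inverse 0 = 0\<close>.\<close>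
  proof (cases "p x = 0")
    case True
    then show ?thesis using u zero by simp
  next
    case False
    have eq: "inverse u = q x / p x" using u by simp
    show ?thesis
      using ratvalsI[OF u(2,1) False eq] act_eq[OF u(2,1) False assms(2)] act_eq[OF u(1-3) assms(2)]
      by (simp add: eq u(4) o_def)
  qed
  then show "inverse u \<in> ratvals" "act \<sigma> (inverse u) = inverse (act \<sigma> u)" by blast+
qed

lemma act_power:
  assumes "u \<in> ratvals" "\<sigma> permutes V"
  shows "u ^ k \<in> ratvals \<and> act \<sigma> (u ^ k) = act \<sigma> u ^ k"
proof (induction k)
  case 0
  show ?case using act_const[OF subfield_one[OF subfield] assms(2)] by simp
next
  case (Suc k)
  then show ?case using act_mult[OF assms(1) _ assms(2), of "u ^ k"] by simp
qed

text \<open>The action is a left action: \<tau> turns \<open>p x\<close> into the value at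
  \<open>x\<close> of the function sending \<open>y\<close> to \<open>p (y \<circ> \<tau>)\<close>,
  and \<sigma> then replaces \<open>x\<close> by \<open>x \<circ> \<sigma>\<close>.\<close>

lemma act_act:
  assumes "u \<in> ratvals" "\<sigma> permutes V" "\<tau> permutes V"
  shows "act \<sigma> (act \<tau> u) = act (\<sigma> \<circ> \<tau>) u"
proof -
  obtain p q where u: "p \<in> polyfun F V" "q \<in> polyfun F V" "q x \<noteq> 0" "u = p x / q x"
    using ratvalsE[OF assms(1)] .
  have \<tau>: "\<tau> ` V \<subseteq> V" using assms(3) by (simp add: permutes_image)
  have "act \<sigma> (act \<tau> u) = act \<sigma> (p (x \<circ> \<tau>) / q (x \<circ> \<tau>))"
    using act_eq[OF u(1-3) assms(3)] u(4) by (simp add: o_def)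
  also have "\<dots> = p (x \<circ> \<sigma> \<circ> \<tau>) / q (x \<circ> \<sigma> \<circ> \<tau>)"
    using act_eq[OF polyfun_permute[OF u(1) \<tau>] polyfun_permute[OF u(2) \<tau>]
        polyfun_permute_nonzero[OF u(2,3) assms(3)] assms(2)] .
  also have "\<dots> = act (\<sigma> \<circ> \<tau>) u"
    using act_eq[OF u(1-3) permutes_compose[OF assms(3,2)]] u(4) by (simp add: o_def)
  finally show ?thesis .
qed

text \<open>An equality of two distinct coordinates would hold at every point, yet an indicator
  function separates them.\<close>

lemma generic_inj_on: "inj_on x V"
proof (rule inj_onI, rule ccontr)
  fix v w
  assume vw: "v \<in> V" "w \<in> V" "x v = x w" "v \<noteq> w"
  then show False
    using polyfun_eqD[OF polyfun.var[OF vw(1)] polyfun.var[OF vw(2)] vw(3),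
        of "\<lambda>i. if i = v then 1 else 0"] by simp
qed

end

section \<open>Three-cycles\<close>

definition cyc3 :: "'v \<Rightarrow> 'v \<Rightarrow> 'v \<Rightarrow> 'v \<Rightarrow> 'v" where
  "cyc3 a b c = id(a := b, b := c, c := a)"

definition three_cycles :: "'v set \<Rightarrow> ('v \<Rightarrow> 'v) set" where
  "three_cycles V = {cyc3 a b c |a b c. {a, b, c} \<subseteq> V \<and> distinct [a, b, c]}"

lemma three_cycles_permutes:
  assumes "\<sigma> \<in> three_cycles V"
  shows "\<sigma> permutes V"
proof -
  obtain a b c where \<sigma>: "\<sigma> = cyc3 a b c" "{a, b, c} \<subseteq> V" "distinct [a, b, c]"
    using assms unfolding three_cycles_def by blast
  have "cyc3 a b c permutes {a, b, c}"
  proof (rule bij_imp_permutes)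
    show "bij_betw (cyc3 a b c) {a, b, c} {a, b, c}"
      using \<sigma>(3) by (auto simp: bij_betw_def inj_on_def cyc3_def)
  qed (simp add: cyc3_def)
  then show ?thesis using \<sigma> permutes_subset by blast
qed

text \<open>Two further elements \<open>d\<close>, \<open>e\<close>, available since
  \<open>card V \<ge> 5\<close>, give the 3-cycles \<open>(a b d)\<close> and
  \<open>(a c e)\<close>, which share only \<open>a\<close> and have \<open>(a b c)\<close> as
  commutator. The equation is arranged to avoid inverses.\<close>

lemma three_cycle_commutator:
  assumes "\<rho> \<in> three_cycles V" "card V \<ge> 5"
  obtains \<sigma> \<tau> where "\<sigma> \<in> three_cycles V" "\<tau> \<in> three_cycles V" "\<rho> \<circ> (\<tau> \<circ> \<sigma>) = \<sigma> \<circ> \<tau>"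
proof -
  obtain a b c where \<rho>: "\<rho> = cyc3 a b c" "{a, b, c} \<subseteq> V" "distinct [a, b, c]"
    using assms unfolding three_cycles_def by blast
  have "card {a, b, c} = 3" using \<rho>(3) by simp
  then have "card (V - {a, b, c}) \<ge> 2" using assms(2) \<rho>(2) by (subst card_Diff_subset) auto
  then obtain D where "D \<subseteq> V - {a, b, c}" "card D = 2"
    by (meson obtain_subset_with_card_n)
  then obtain d e where de: "d \<in> V - {a, b, c}" "e \<in> V - {a, b, c}" "d \<noteq> e"
    by (auto simp: card_2_iff)
  show thesis
  proof (rule that)
    show "cyc3 a b d \<in> three_cycles V" "cyc3 a c e \<in> three_cycles V"
      using \<rho>(2,3) de unfolding three_cycles_def by fastforce+
    show "\<rho> \<circ> (cyc3 a c e \<circ> cyc3 a b d) = cyc3 a b d \<circ> cyc3 a c e"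
      using \<rho>(3) de unfolding \<rho>(1) cyc3_def by (auto simp: fun_eq_iff)
  qed
qed

section \<open>The field fixed by all 3-cycles: roots, coefficients and coordinates\<close>

context generic_point
begin

text \<open>For finite \<open>V\<close> this is the fixed field of the alternating group, which the
  3-cycles generate. Transpositions must be left out: the product of the differences of the
  coordinates has a symmetric square but changes sign under them.\<close>

definition fixed_field :: "complex set" where
  "fixed_field = {u \<in> ratvals. \<forall>\<sigma>\<in>three_cycles V. act \<sigma> u = u}"

lemma fixed_fieldD:
  assumes "u \<in> fixed_field"
  shows "u \<in> ratvals" "\<sigma> \<in> three_cycles V \<Longrightarrow> act \<sigma> u = u"
  using assms by (simp_all add: fixed_field_def)

lemma subfield_ratvals: "subfield ratvals complex_ring"
  unfolding subfield_complex_iff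
proof (intro conjI ballI)
  show "1 \<in> ratvals"
    \<comment> \<open>The membership halves of the \<open>act\<close> lemmas do not mention
      \<sigma>, so the identity serves as the permutation here and below.\<close>
    by (rule act_const(1)[OF subfield_one[OF subfield] permutes_id])
next
  fix a assume a: "a \<in> ratvals"
  have "- 1 \<in> F" using subfield by (simp add: subfield_one subfield_uminus)
  then show "- a \<in> ratvals"
    using act_mult(1)[OF act_const(1)[OF _ permutes_id] a permutes_id, of "- 1"] by simp
  show "inverse a \<in> ratvals" using act_inverse(1)[OF a permutes_id] .
  fix b assume b: "b \<in> ratvals"
  show "a + b \<in> ratvals" using act_add(1)[OF a b permutes_id] .
  show "a * b \<in> ratvals" using act_mult(1)[OF a b permutes_id] .
qed

lemma subfield_fixed_field: "subfield fixed_field complex_ring"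
  unfolding subfield_complex_iff
proof (intro conjI ballI)
  show one: "1 \<in> fixed_field"
    using act_const[OF subfield_one[OF subfield]] three_cycles_permutes permutes_id
    unfolding fixed_field_def by blast
next
  fix a assume a: "a \<in> fixed_field"
  have "- 1 \<in> F" using subfield by (simp add: subfield_one subfield_uminus)
  then have "act \<sigma> (- 1 * a) = - 1 * a" if "\<sigma> \<in> three_cycles V" for \<sigma>
    using act_mult(2)[of "- 1" a \<sigma>] act_const[of "- 1" \<sigma>] a three_cycles_permutes[OF that] that
    unfolding fixed_field_def by simp
  then show "- a \<in> fixed_field"
    using a subfield_uminus[OF subfield_ratvals] unfolding fixed_field_def by simp
next
  fix a assume a: "a \<in> fixed_field"
  have "act \<sigma> (inverse a) = inverse a" if \<sigma>: "\<sigma> \<in> three_cycles V" for \<sigma>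
    using act_inverse(2)[OF fixed_fieldD(1)[OF a] three_cycles_permutes[OF \<sigma>]]
      fixed_fieldD(2)[OF a \<sigma>] by simp
  then show "inverse a \<in> fixed_field"
    using subfield_inverse[OF subfield_ratvals fixed_fieldD(1)[OF a]] by (simp add: fixed_field_def)
next
  fix a b assume ab: "a \<in> fixed_field" "b \<in> fixed_field"
  note rat = fixed_fieldD(1)[OF ab(1)] fixed_fieldD(1)[OF ab(2)]
  have "act \<sigma> (a + b) = a + b" "act \<sigma> (a * b) = a * b" if \<sigma>: "\<sigma> \<in> three_cycles V" for \<sigma>
    using act_add(2)[OF rat three_cycles_permutes[OF \<sigma>]]
      act_mult(2)[OF rat three_cycles_permutes[OF \<sigma>]] fixed_fieldD(2)[OF _ \<sigma>] ab
    by simp_all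
  then show "a + b \<in> fixed_field" "a * b \<in> fixed_field"
    using subfield_add[OF subfield_ratvals rat] subfield_mult[OF subfield_ratvals rat]
    by (simp_all add: fixed_field_def)
qed

text \<open>Each 3-cycle scales \<open>r\<close> by a root of unity. By \<open>roots\<close> this
  scalar lies in \<open>F\<close>, so every permutation fixes it; hence the scalings by two 3-cycles
  commute, and a commutator of them acts trivially on \<open>r\<close>.\<close>

lemma fixed_field_root:
  assumes roots: "\<And>\<zeta> k. \<zeta> ^ k = 1 \<Longrightarrow> k > 0 \<Longrightarrow> \<zeta> \<in> F"
    and card: "card V \<ge> 5"
    and r: "r \<in> ratvals" "k > 0" "r ^ k \<in> fixed_field"
  shows "r \<in> fixed_field"
proof (cases "r = 0")
  case True
  then show ?thesis using subfield_zero[OF subfield_fixed_field] by simp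
next
  case False
  have scale: "\<exists>\<zeta>\<in>F. \<zeta> \<noteq> 0 \<and> act \<sigma> r = \<zeta> * r" if \<sigma>: "\<sigma> \<in> three_cycles V" for \<sigma>
  proof
    let ?\<zeta> = "act \<sigma> r / r"
    have "act \<sigma> r ^ k = r ^ k"
      using act_power[OF r(1) three_cycles_permutes[OF \<sigma>], of k] r(3) \<sigma>
      unfolding fixed_field_def by simp
    then have root: "?\<zeta> ^ k = 1" using False by (simp add: power_divide)
    then show "?\<zeta> \<in> F" using roots r(2) by blast
    show "?\<zeta> \<noteq> 0 \<and> act \<sigma> r = ?\<zeta> * r" using root r(2) False by (auto simp: zero_power)
  qed
  have "act \<rho> r = r" if \<rho>: "\<rho> \<in> three_cycles V" for \<rho>
  proof -
    obtain \<sigma> \<tau> where st: "\<sigma> \<in> three_cycles V" "\<tau> \<in> three_cycles V" "\<rho> \<circ> (\<tau> \<circ> \<sigma>) = \<sigma> \<circ> \<tau>"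
      using three_cycle_commutator[OF \<rho> card] .
    note perm = three_cycles_permutes[OF \<rho>]
      three_cycles_permutes[OF st(1)] three_cycles_permutes[OF st(2)]
    obtain \<zeta> where \<zeta>: "\<zeta> \<in> F" "\<zeta> \<noteq> 0" "act \<sigma> r = \<zeta> * r" using scale[OF st(1)] by blast
    obtain \<xi> where \<xi>: "\<xi> \<in> F" "\<xi> \<noteq> 0" "act \<tau> r = \<xi> * r" using scale[OF st(2)] by blast
    have act_scaled: "act \<pi> (c * r) = c * act \<pi> r" if "c \<in> F" "\<pi> permutes V" for c \<pi>
      using act_mult(2)[OF act_const(1)[OF that] r(1) that(2)] act_const(2)[OF that] by simp
    have st_r: "act (\<sigma> \<circ> \<tau>) r = \<zeta> * \<xi> * r"
      using act_act[OF r(1) perm(2,3)] act_scaled[OF \<xi>(1) perm(2)] \<zeta> \<xi> by (simp add: mult_ac)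
    have ts_r: "act (\<tau> \<circ> \<sigma>) r = \<zeta> * \<xi> * r"
      using act_act[OF r(1) perm(3,2)] act_scaled[OF \<zeta>(1) perm(3)] \<zeta> \<xi> by (simp add: mult_ac)
    \<comment> \<open>Both orders of \<sigma> and \<tau> scale \<open>r\<close> by the same nonzero
      factor, which cancels once the relation with \<rho> is applied to \<open>r\<close>.\<close>
    have "\<zeta> * \<xi> * act \<rho> r = act \<rho> (\<zeta> * \<xi> * r)"
      using act_scaled[OF subfield_mult[OF subfield \<zeta>(1) \<xi>(1)] perm(1)] by simp
    also have "\<dots> = act (\<rho> \<circ> (\<tau> \<circ> \<sigma>)) r"
      using act_act[OF r(1) perm(1) permutes_compose[OF perm(2,3)]] ts_r by simp
    also have "\<dots> = \<zeta> * \<xi> * r" using st(3) st_r by simp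
    finally show ?thesis using \<zeta>(2) \<xi>(2) by simp
  qed
  then show ?thesis using r(1) unfolding fixed_field_def by blast
qed

text \<open>Up to sign these are the elementary symmetric polynomials; the induction multiplies by
  one linear factor at a time.\<close>

lemma coeff_prod_linear_polyfun:
  assumes "finite W" "W \<subseteq> V"
  shows "(\<lambda>y. coeff (\<Prod>j\<in>W. [:- y j, 1:]) i) \<in> polyfun F V"
  using assms
proof (induction W arbitrary: i rule: finite_induct)
  case empty
  then show ?case
    using subfield_zero[OF subfield] subfield_one[OF subfield]
    by (cases i) (auto intro: polyfun.intros)
next
  case (insert w W)
  let ?c = "\<lambda>i y. coeff (\<Prod>j\<in>W. [:- y j, 1:]) i"
  have neg: "- 1 \<in> F" using subfield by (simp add: subfield_one subfield_uminus)
  have zero: "(\<lambda>_. 0) \<in> polyfun F V" using subfield_zero[OF subfield] by (rule polyfun.const)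
  \<comment> \<open>The contribution of the leading term of the new factor, which shifts
    coefficients up by one; at index 0 it is zero.\<close>
  have "(\<lambda>y. if i = 0 then 0 else ?c (i - 1) y) \<in> polyfun F V"
    using insert zero by (cases "i = 0") auto
  then have "(\<lambda>y. (- 1) * y w * ?c i y + (if i = 0 then 0 else ?c (i - 1) y)) \<in> polyfun F V"
    using insert neg by (intro polyfun.add polyfun.mult polyfun.const polyfun.var) auto
  moreover have "coeff (\<Prod>j\<in>insert w W. [:- y j, 1:]) i =
      (- 1) * y w * ?c i y + (if i = 0 then 0 else ?c (i - 1) y)" for y :: "'v \<Rightarrow> complex"
    using insert.hyps by (simp add: coeff_pCons split: nat.split)
  ultimately show ?case by simp
qed

text \<open>Permuting the coordinates merely reorders the factors of the product.\<close>

lemma coeff_prod_linear_fixed: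
  assumes "finite V"
  shows "coeff (\<Prod>j\<in>V. [:- x j, 1:]) i \<in> fixed_field"
proof -
  note e = coeff_prod_linear_polyfun[OF assms order_refl, of i]
  have "act \<sigma> (coeff (\<Prod>j\<in>V. [:- x j, 1:]) i) = coeff (\<Prod>j\<in>V. [:- x j, 1:]) i"
    if "\<sigma> permutes V" for \<sigma>
    using act_polyfun(2)[OF e that] prod.permute[OF that, of "\<lambda>j. [:- x j, 1:]"]
    by (simp add: o_def)
  then show ?thesis
    using act_polyfun(1)[OF e permutes_id] three_cycles_permutes unfolding fixed_field_def by blast
qed

text \<open>A 3-cycle through \<open>v\<close> sends \<open>x v\<close> to another coordinate, which
  differs from it by \<open>generic_inj_on\<close>.\<close>

lemma coordinate_not_fixed:
  assumes "v \<in> V" "card V \<ge> 5"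
  shows "x v \<notin> fixed_field"
proof
  assume fixed: "x v \<in> fixed_field"
  have "card (V - {v}) \<ge> 2" using assms by simp
  then obtain D where "D \<subseteq> V - {v}" "card D = 2"
    by (meson obtain_subset_with_card_n)
  then obtain b c where bc: "b \<in> V - {v}" "c \<in> V - {v}" "b \<noteq> c"
    by (auto simp: card_2_iff)
  then have cyc: "cyc3 v b c \<in> three_cycles V"
    using assms(1) unfolding three_cycles_def by fastforce
  have "x v = act (cyc3 v b c) (x v)" using fixed cyc unfolding fixed_field_def by simp
  also have "\<dots> = x (cyc3 v b c v)" by (rule act_var(2)[OF assms(1) three_cycles_permutes[OF cyc]])
  also have "\<dots> = x b" using bc by (auto simp: cyc3_def)
  finally show False using inj_onD[OF generic_inj_on] bc assms(1) by blast
qed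

end

theorem theorem2:
  fixes n :: nat
  assumes "n \<ge> 5"
  shows "\<exists>(a :: nat \<Rightarrow> complex) (x :: nat \<Rightarrow> complex).
           (\<forall>z. z ^ n + (\<Sum>i<n. a i * z ^ i) = (\<Prod>j\<in>{1..n}. z - x j)) \<and>
           (\<forall>K. radical_extension (adjoin Q_eps (a ` {..<n})) K \<and>
                K \<subseteq> adjoin Q_eps (x ` {1..n}) \<longrightarrow>
                (\<forall>z. z ^ n + (\<Sum>i<n. a i * z ^ i) = 0 \<longrightarrow> z \<notin> K))"
proof -
  \<comment> \<open>Adjoining nothing yields a subfield containing \<open>Q_eps\<close> at once,
    with no separate proof that the union \<open>Q_eps\<close> is a field.\<close>
  define F where "F = adjoin Q_eps {}"
  define V where "V = {1..n}"
  have V: "finite V" "card V = n" by (simp_all add: V_def)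
  have F: "subfield F complex_ring" unfolding F_def by (rule subfield_adjoin)
  have "countable F" unfolding F_def by (intro countable_adjoin countable_Q_eps) simp
  then obtain x where "generic F V x"
    using ex_generic subfield_infinite[OF F] V(1) by blast
  then interpret generic_point F V x by (rule generic_point.intro[OF F])
  \<comment> \<open>The roots are chosen first and the coefficients are read off from the product,
    which is monic of degree \<open>n\<close>.\<close>
  define P where "P = (\<Prod>j\<in>V. [:- x j, 1:])"
  define a where "a = coeff P"
  have "degree P = n" unfolding P_def using V by (subst degree_prod_eq_sum_degree) auto
  moreover have "lead_coeff P = 1" unfolding P_def by (simp add: lead_coeff_prod)
  ultimately have "poly P z = z ^ n + (\<Sum>i<n. a i * z ^ i)" for z
    unfolding poly_altdef a_def by (simp add: lessThan_Suc_atMost[symmetric])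
  moreover have "poly P z = (\<Prod>j\<in>V. z - x j)" for z
    by (simp add: P_def poly_prod)
  ultimately have eq: "z ^ n + (\<Sum>i<n. a i * z ^ i) = (\<Prod>j\<in>V. z - x j)" for z
    by metis
  have roots: "\<zeta> \<in> F" if "\<zeta> ^ k = 1" "k > 0" for \<zeta> k
    unfolding F_def using root_of_unity_in_adjoin_Q_eps[OF that] .
  have Q_eps: "Q_eps \<subseteq> fixed_field"
    using subset_adjoin(1)[of Q_eps "{}"] act_const three_cycles_permutes permutes_id
    unfolding F_def[symmetric] fixed_field_def by blast
  have L: "adjoin Q_eps (x ` V) \<subseteq> ratvals"
    unfolding adjoin_subset_iff[OF subfield_ratvals]
    using Q_eps act_var(1)[OF _ permutes_id] unfolding fixed_field_def by blast
  have base: "adjoin Q_eps (a ` {..<n}) \<subseteq> fixed_field"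
    unfolding adjoin_subset_iff[OF subfield_fixed_field]
    using Q_eps coeff_prod_linear_fixed[OF V(1)] by (auto simp: a_def P_def)
  have "z \<notin> K"
    if K: "radical_extension (adjoin Q_eps (a ` {..<n})) K" "K \<subseteq> adjoin Q_eps (x ` V)"
      and z: "(\<Prod>j\<in>V. z - x j) = 0" for K z
  proof -
    have "K \<subseteq> fixed_field"
      using K(1) subfield_fixed_field base
    proof (rule radical_extension_subset)
      fix u k assume u: "u \<in> K" "k > 0" "u ^ k \<in> fixed_field"
      \<comment> \<open>The containment of \<open>K\<close> in the field generated by the roots
        enters here: it places \<open>u\<close> where the permutations act.\<close>
      have "card V \<ge> 5" "u \<in> ratvals" using V(2) assms u(1) K(2) L by auto
      with roots show "u \<in> fixed_field" using u(2,3) by (rule fixed_field_root)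
    qed
    moreover obtain j where "j \<in> V" "z = x j" using z V(1) by auto
    ultimately show ?thesis using coordinate_not_fixed V(2) assms by blast
  qed
  then show ?thesis using eq unfolding V_def by metis
qed

end
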